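(* For each $n$ let $p(n)\in[0,1]$ and let $G\sim\vec{G}(n,p(n))$ be an Erdős–Rényi random directed graph. Let $\vec\beta_0(G)$ denote the $0$-th Betti number of its non-regular path homology. Let $f$ be defined by $1-(1-p(n))^2=(\log(n)+f(n))/n$. Then: (a) if $\lim_{n\to\infty}f(n)=-\infty$ then $\vec\beta_0(G)>0$ with high probability; (b) if $\lim_{n\to\infty}f(n)=\infty$ then $\vec\beta_0(G)=0$ with high probability. The same result holds with $\vec\beta_0(G)$ replaced by the $0$-th Betti number $\vec\beta^{\mathrm{reg}}_0(G)$ of regular path homology.
   Context: A simple digraph is $G=(V,E)$ with $E\subseteq\{(i,j)\in V\times V: i\neq j\}$ (both $(i,j)$ and $(j,i)$ may be present). $\vec{G}(n,p)$ is the random simple digraph on vertex set $\{1,\dots,n\}$ in which each of the $n(n-1)$ possible directed edges is present independently with probability $p$. A property holds with high probability if its probability tends to $1$ as $n\to\infty$. Path homology (coefficients in $\mathbb{Z}$). For $m\ge 0$ let $\Lambda_m$ be the free $\mathbb{Z}$-module with basis $e_{v_0\dots v_m}$ over all sequences of $m+1$ vertices, and let $\mathcal{A}_m\subseteq\Lambda_m$ be the submodule spanned by the allowed sequences, i.e. those with $(v_i,v_{i+1})\in E$ for all $i$. Put $\Lambda_{-1}=\mathcal{A}_{-1}=\mathbb{Z}$. For $m\geq 1$ let $\partial_m:\Lambda_m\to\Lambda_{m-1}$, $\partial_m(e_{v_0\dots v_m})=\sum_{i=0}^m(-1)^i e_{v_0\dots\hat{v_i}\dots v_m}$, and let $\partial_0:\Lambda_0\to\mathbb{Z}$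 be the sum of coefficients. Let $\Omega_m=\{v\in\mathcal{A}_m:\partial_m v\in\mathcal{A}_{m-1}\}$ for $m\ge0$ and $\Omega_{-1}=\mathbb{Z}$. The non-regular chain complex is $\cdots\to\Omega_2\to\Omega_1\to\Omega_0\to\mathbb{Z}\to0$ with the restrictions of $\partial_m$; its homology is non-regular path homology and $\vec\beta_k(G)=\operatorname{rank}(\ker\partial_k/\operatorname{im}\partial_{k+1})$ (so this is a reduced homology). For the regular version, let $\pi$ be the projection sending every basis sequence having two equal consecutive vertices to $0$ and fixing the others, let $\partial^{\mathrm{reg}}_m=\pi\circ\partial_m$, $\Omega^{\mathrm{reg}}_m=\{v\in\mathcal{A}_m:\partial^{\mathrm{reg}}_m v\in\mathcal{A}_{m-1}\}$ (again augmented by $\mathbb{Z}$ in degree $-1$); $\vec\beta^{\mathrm{reg}}_k(G)$ is the rank of the $k$-th homology group of this complex. *)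

theory Defs
  imports
    "HOL-Probability.Probability"
    "HOL-Algebra.Free_Abelian_Groups"
    "Graph_Theory.Pair_Digraph"
begin

section \<open>Random simple digraphs\<close>

text \<open>
  A finite simple digraph is a \<^typ>\<open>'a pair_pre_digraph\<close> satisfying
  \<^locale>\<open>pair_digraph\<close>: finite, no loops, arcs are ordered pairs of vertices.
\<close>

definition arc_slots :: "nat \<Rightarrow> (nat \<times> nat) set" where
  "arc_slots n = {(i, j). i \<in> {1..n} \<and> j \<in> {1..n} \<and> i \<noteq> j}"

definition random_digraph :: "nat \<Rightarrow> real \<Rightarrow> nat pair_pre_digraph pmf" where
  "random_digraph n p =
     map_pmf (\<lambda>present. \<lparr> pverts = {1..n}, parcs = {e \<in> arc_slots n. present e} \<rparr>)
       (Pi_pmf (arc_slots n) False (\<lambda>_. bernoulli_pmf p))"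

lemma finite_arc_slots: "finite (arc_slots n)"
  by (rule finite_subset[of _ "{1..n} \<times> {1..n}"]) (auto simp: arc_slots_def)

lemma random_digraph_simple:
  assumes "G \<in> set_pmf (random_digraph n p)"
  shows "pair_digraph G" "pverts G = {1..n}"
proof -
  obtain A where G: "G = \<lparr> pverts = {1..n}, parcs = {e \<in> arc_slots n. A e} \<rparr>"
    using assms by (auto simp: random_digraph_def)
  have "finite {e \<in> arc_slots n. A e}"
    using finite_arc_slots by simp
  then show "pair_digraph G"
    unfolding G by unfold_locales (auto simp: arc_slots_def)
  show "pverts G = {1..n}"
    by (simp add: G)
qed

section \<open>Path homology\<close>

text \<open>
  Degrees are integers. A basis sequence of degree \<open>m\<close> is a list of \<open>m + 1\<close> vertices, and
  \<open>\<Lambda>\<^sub>m\<close> is the free Abelian group over these lists. In degree \<open>-1\<close> the only such list is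
  \<open>[]\<close>, so \<open>\<Lambda>\<^sub>-\<^sub>1\<close> is \<open>\<int>\<close> generated by \<open>[]\<close>; the general boundary formula then yields the
  augmentation in degree \<open>0\<close>, and \<open>0\<close> in degree \<open>-1\<close>.
\<close>

definition vertex_seqs :: "'a pair_pre_digraph \<Rightarrow> int \<Rightarrow> 'a list set" where
  "vertex_seqs G m = {xs. int (length xs) = m + 1 \<and> set xs \<subseteq> pverts G}"

definition allowed_seqs :: "'a pair_pre_digraph \<Rightarrow> int \<Rightarrow> 'a list set" where
  "allowed_seqs G m = {xs \<in> vertex_seqs G m. successively (\<lambda>u v. (u, v) \<in> parcs G) xs}"

definition seq_group :: "'a pair_pre_digraph \<Rightarrow> int \<Rightarrow> ('a list \<Rightarrow>\<^sub>0 int) monoid" where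
  "seq_group G m = free_Abelian_group (vertex_seqs G m)"

definition allowed_chains :: "'a pair_pre_digraph \<Rightarrow> int \<Rightarrow> ('a list \<Rightarrow>\<^sub>0 int) set" where
  "allowed_chains G m = carrier (free_Abelian_group (allowed_seqs G m))"

definition bdry :: "('a list \<Rightarrow>\<^sub>0 int) \<Rightarrow> ('a list \<Rightarrow>\<^sub>0 int)" where
  "bdry = frag_extend
     (\<lambda>xs. \<Sum>i<length xs. frag_cmul ((-1) ^ i) (frag_of (take i xs @ drop (Suc i) xs)))"

text \<open>\<^term>\<open>distinct_adj xs\<close> says that no two consecutive entries of \<open>xs\<close> are equal.\<close>

definition regular_proj :: "('a list \<Rightarrow>\<^sub>0 int) \<Rightarrow> ('a list \<Rightarrow>\<^sub>0 int)" where
  "regular_proj = frag_extend (\<lambda>xs. if distinct_adj xs then frag_of xs else 0)"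

definition regular_bdry :: "('a list \<Rightarrow>\<^sub>0 int) \<Rightarrow> ('a list \<Rightarrow>\<^sub>0 int)" where
  "regular_bdry = regular_proj \<circ> bdry"

lemma bdry_vertex: "bdry (frag_of [v]) = frag_of []"
  by (simp add: bdry_def)

lemma bdry_arc: "bdry (frag_of [u, v]) = frag_of [v] - frag_of [u]"
  by (simp add: bdry_def lessThan_Suc)

text \<open>
  The following definitions take the boundary map \<open>d\<close> as a parameter: \<^const>\<open>bdry\<close> gives the
  non-regular and \<^const>\<open>regular_bdry\<close> the regular version.
\<close>

definition path_chains ::
  "(('a list \<Rightarrow>\<^sub>0 int) \<Rightarrow> ('a list \<Rightarrow>\<^sub>0 int)) \<Rightarrow> 'a pair_pre_digraph \<Rightarrow> int \<Rightarrow> ('a list \<Rightarrow>\<^sub>0 int) set"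
  where "path_chains d G m = {c \<in> allowed_chains G m. d c \<in> allowed_chains G (m - 1)}"

definition path_cycles ::
  "(('a list \<Rightarrow>\<^sub>0 int) \<Rightarrow> ('a list \<Rightarrow>\<^sub>0 int)) \<Rightarrow> 'a pair_pre_digraph \<Rightarrow> int \<Rightarrow> ('a list \<Rightarrow>\<^sub>0 int) set"
  where "path_cycles d G m = {c \<in> path_chains d G m. d c = 0}"

definition path_boundaries ::
  "(('a list \<Rightarrow>\<^sub>0 int) \<Rightarrow> ('a list \<Rightarrow>\<^sub>0 int)) \<Rightarrow> 'a pair_pre_digraph \<Rightarrow> int \<Rightarrow> ('a list \<Rightarrow>\<^sub>0 int) set"
  where "path_boundaries d G m = d ` path_chains d G (m + 1)"

definition path_homology_group ::
  "(('a list \<Rightarrow>\<^sub>0 int) \<Rightarrow> ('a list \<Rightarrow>\<^sub>0 int)) \<Rightarrow> 'a pair_pre_digraph \<Rightarrow> int \<Rightarrow> ('a list \<Rightarrow>\<^sub>0 int) set monoid"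
  where "path_homology_group d G m =
    subgroup_generated (seq_group G m) (path_cycles d G m) Mod path_boundaries d G m"

text \<open>
  The rank of a (multiplicatively written) Abelian group is the largest size of a
  \<open>\<int>\<close>-linearly independent subset; it is an \<^typ>\<open>enat\<close>, so no finiteness is presupposed.
\<close>

definition int_independent :: "('a, 'b) monoid_scheme \<Rightarrow> 'a set \<Rightarrow> bool" where
  "int_independent A B \<longleftrightarrow> finite B \<and> B \<subseteq> carrier A \<and>
     (\<forall>c :: 'a \<Rightarrow> int. finprod A (\<lambda>b. b [^]\<^bsub>A\<^esub> c b) B = \<one>\<^bsub>A\<^esub> \<longrightarrow> (\<forall>b\<in>B. c b = 0))"

definition abelian_rank :: "('a, 'b) monoid_scheme \<Rightarrow> enat" where
  "abelian_rank A = (SUP B \<in> {B. int_independent A B}. enat (card B))"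

definition betti :: "int \<Rightarrow> 'a pair_pre_digraph \<Rightarrow> enat" where
  "betti k G = abelian_rank (path_homology_group bdry G k)"

definition regular_betti :: "int \<Rightarrow> 'a pair_pre_digraph \<Rightarrow> enat" where
  "regular_betti k G = abelian_rank (path_homology_group regular_bdry G k)"

section \<open>Events holding with high probability\<close>

definition whp :: "(nat \<Rightarrow> 'a pmf) \<Rightarrow> ('a \<Rightarrow> bool) \<Rightarrow> bool" where
  "whp D P \<longleftrightarrow> (\<lambda>n. measure_pmf.prob (D n) {x. P x}) \<longlonglongrightarrow> 1"

end

theory Submission
  imports Defs "HOL-Real_Asymp.Real_Asymp"
begin

text \<open>
  In degrees at most one the regular and the non-regular boundary maps agree on allowed chains, so
  both zeroth Betti numbers coincide, and they vanish precisely when no proper nonempty vertex set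
  is cut off from its complement. Two vertices are joined by no arc in either direction with
  probability \<open>q = (1 - p)\<^sup>2\<close>, so the threshold is that of connectivity of the undirected random
  graph with edge probability \<open>1 - q\<close>. Above it, a union bound over vertex sets of size
  \<open>k \<le> n / 2\<close> is dominated by a geometric series with ratio \<open>exp (2 - f / 2)\<close>. Below it, the second
  moment method yields an isolated vertex.
\<close>

section \<open>Ranks of quotient groups\<close>

lemma (in comm_group) abelian_rank_Mod_self:
  "abelian_rank (G Mod carrier G) = 0"
proof -
  let ?Q = "G Mod carrier G"
  interpret Q: comm_group ?Q
    by (rule abelian_FactGroup[OF subgroup_self])
  have carrier: "carrier ?Q = {\<one>\<^bsub>?Q\<^esub>}"
    by (auto simp: carrier_FactGroup coset_join2[OF _ subgroup_self])
  have "B = {}" if "int_independent ?Q B" for B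
  proof -
    \<comment> \<open>In the trivial group every product is the identity, so the constant
      coefficient 1 contradicts independence unless \<open>B\<close> is empty.\<close>
    have "finprod ?Q (\<lambda>b. b [^]\<^bsub>?Q\<^esub> (1::int)) B = \<one>\<^bsub>?Q\<^esub>"
      using that carrier by (intro Q.finprod_one_eqI) (auto simp: int_independent_def)
    with that have "\<forall>b\<in>B. (1::int) = 0"
      unfolding int_independent_def by (elim conjE allE[of _ "\<lambda>_. 1"]) blast
    then show ?thesis by auto
  qed
  then have "enat (card B) \<le> 0" if "int_independent ?Q B" for B
    using that by (fastforce simp: zero_enat_def)
  then have "abelian_rank ?Q \<le> 0"
    unfolding abelian_rank_def by (intro SUP_least) simp
  then show ?thesis
    by simp
qed

text \<open>The coset of \<open>x\<close> alone is an independent set: a relation \<open>k\<close>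
  on it says that the \<open>k\<close>-th power of \<open>x\<close> lies in
  \<open>H\<close>.\<close>

lemma (in comm_group) abelian_rank_Mod_pos:
  assumes "subgroup H G" "x \<in> carrier G"
    and torsion_free: "\<And>k :: int. x [^] k \<in> H \<Longrightarrow> k = 0"
  shows "abelian_rank (G Mod H) > 0"
proof -
  interpret Q: comm_group "G Mod H"
    by (rule abelian_FactGroup[OF assms(1)])
  interpret N: normal H G
    using assms(1) by (simp add: normal_iff_subgroup)
  have x: "H #> x \<in> carrier (G Mod H)"
    using assms(2) by (auto simp: carrier_FactGroup)
  have "int_independent (G Mod H) {H #> x}"
    unfolding int_independent_def
  proof (intro conjI allI impI ballI)
    fix c :: "'a set \<Rightarrow> int" and b
    assume "finprod (G Mod H) (\<lambda>b. b [^]\<^bsub>G Mod H\<^esub> c b) {H #> x} = \<one>\<^bsub>G Mod H\<^esub>"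
    also have "finprod (G Mod H) (\<lambda>b. b [^]\<^bsub>G Mod H\<^esub> c b) {H #> x} = H #> (x [^] c (H #> x))"
      using Q.int_pow_closed[OF x] assms(2)
      by (simp add: N.FactGroup_int_pow del: mult_FactGroup one_FactGroup)
    finally have "H #> (x [^] c (H #> x)) = H"
      by simp
    then have "x [^] c (H #> x) \<in> H"
      by (rule coset_join1) (use assms(1,2) in auto)
    moreover assume "b \<in> {H #> x}"
    ultimately show "c b = 0"
      using torsion_free by simp
  qed (use x in auto)
  then have "enat (card {H #> x}) \<le> abelian_rank (G Mod H)"
    unfolding abelian_rank_def by (intro SUP_upper) simp
  then show ?thesis
    by (cases "abelian_rank (G Mod H)") (auto simp: zero_enat_def)
qed

section \<open>Path homology in degree zero\<close>

lemma allowed_seqs_nonpos: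
  assumes "m \<le> 0"
  shows "allowed_seqs G m = vertex_seqs G m"
proof -
  have "successively P xs" if "length xs \<le> 1" for P and xs :: "'a list"
    using that by (cases xs) auto
  then show ?thesis
    using assms by (auto simp: allowed_seqs_def vertex_seqs_def)
qed

lemma keys_bdry:
  assumes "Poly_Mapping.keys c \<subseteq> vertex_seqs G m"
  shows "Poly_Mapping.keys (bdry c) \<subseteq> vertex_seqs G (m - 1)"
proof -
  have "Poly_Mapping.keys (\<Sum>i<length xs. frag_cmul ((-1) ^ i) (frag_of (take i xs @ drop (Suc i) xs)))
      \<subseteq> vertex_seqs G (m - 1)" if "xs \<in> vertex_seqs G m" for xs
    using that
    by (intro order.trans[OF keys_sum] UN_least order.trans[OF keys_cmul])
       (auto simp: vertex_seqs_def keys_frag_of dest: in_set_takeD in_set_dropD)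
  then show ?thesis
    using assms unfolding bdry_def by (intro order.trans[OF keys_frag_extend]) blast
qed

text \<open>The boundary lands in degree at most zero, where sequences have no consecutive pairs and
  are therefore all allowed.\<close>

lemma path_chains_bdry_le1:
  assumes "m \<le> 1"
  shows "path_chains bdry G m = allowed_chains G m"
proof -
  have "bdry c \<in> allowed_chains G (m - 1)" if "c \<in> allowed_chains G m" for c
    using that assms keys_bdry[of c G m]
    by (auto simp: allowed_chains_def allowed_seqs_nonpos) (auto simp: allowed_seqs_def)
  then show ?thesis by (auto simp: path_chains_def)
qed

lemma regular_proj_nonpos:
  assumes "m \<le> 0" "Poly_Mapping.keys c \<subseteq> vertex_seqs G m"
  shows "regular_proj c = c"
proof -
  have "distinct_adj xs" if "xs \<in> vertex_seqs G m" for xs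
    using that assms(1) by (cases xs) (auto simp: vertex_seqs_def)
  then have "regular_proj c = frag_extend frag_of c"
    using assms(2) unfolding regular_proj_def by (intro frag_extend_eq) auto
  then show ?thesis
    by (simp flip: frag_expansion)
qed

lemma regular_bdry_le1:
  assumes "m \<le> 1" "c \<in> allowed_chains G m"
  shows "regular_bdry c = bdry c"
  unfolding regular_bdry_def o_def
  using assms by (intro regular_proj_nonpos[of "m - 1" _ G] keys_bdry)
    (auto simp: allowed_chains_def allowed_seqs_def)

text \<open>Homology in degree zero sees only chains of degrees 1 and 0 and their boundaries. Those
  boundaries consist of sequences of length at most one, which \<open>regular_proj\<close>
  fixes.\<close>

lemma regular_betti_0: "regular_betti 0 G = betti 0 G"
proof -
  have "path_chains regular_bdry G m = path_chains bdry G m" if "m \<le> 1" for m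
    using regular_bdry_le1[OF that, of _ G] by (auto simp: path_chains_def)
  moreover have "regular_bdry ` path_chains bdry G 1 = bdry ` path_chains bdry G 1"
    using regular_bdry_le1[of 1 _ G] by (intro image_cong) (auto simp: path_chains_def)
  moreover have "regular_bdry c = bdry c" if "c \<in> path_chains bdry G 0" for c
    using that by (intro regular_bdry_le1[of 0 _ G]) (auto simp: path_chains_def)
  ultimately show ?thesis
    by (auto simp: betti_def regular_betti_def path_homology_group_def path_cycles_def
        path_boundaries_def intro!: arg_cong[where f = abelian_rank] arg_cong2[where f = FactGroup]
        arg_cong2[where f = subgroup_generated])
qed

section \<open>Cycles and boundaries in degree zero as subgroups\<close>

lemma bdry_diff: "bdry (a - b) = bdry a - bdry b"
  unfolding bdry_def by (rule frag_extend_diff)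

lemma bdry_0 [simp]: "bdry 0 = 0"
  by (simp add: bdry_def)

lemma vertex_seqs_0: "vertex_seqs G 0 = (\<lambda>v. [v]) ` pverts G"
  by (auto simp: vertex_seqs_def length_Suc_conv)

lemma allowed_seqs_1:
  "allowed_seqs G 1 = {[u, v] |u v. u \<in> pverts G \<and> v \<in> pverts G \<and> (u, v) \<in> parcs G}"
proof -
  have "length xs = 2 \<longleftrightarrow> (\<exists>u v. xs = [u, v])" for xs :: "'a list"
    by (auto simp: length_Suc_conv numeral_2_eq_2)
  moreover have "int (length xs) = 2 \<longleftrightarrow> length xs = 2" for xs :: "'a list"
    by linarith
  ultimately show ?thesis
    by (auto simp: allowed_seqs_def vertex_seqs_def)
qed

lemma bdry_bdry_1:
  assumes "c \<in> allowed_chains G 1"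
  shows "bdry (bdry c) = 0"
proof -
  have "Poly_Mapping.keys c \<subseteq> allowed_seqs G 1"
    using assms by (simp add: allowed_chains_def)
  then show ?thesis
    by (induction c rule: frag_induction)
       (auto simp: allowed_seqs_1 bdry_arc bdry_diff bdry_vertex)
qed

text \<open>Negation is subtraction from 0 and addition is subtraction of a negative. Closure under
  differences suits \<open>bdry\<close> and \<open>frag_induction\<close>.\<close>

lemma subgroup_free_Abelian_groupI:
  assumes "H \<subseteq> carrier (free_Abelian_group S)" "0 \<in> H" "\<And>a b. a \<in> H \<Longrightarrow> b \<in> H \<Longrightarrow> a - b \<in> H"
  shows "subgroup H (free_Abelian_group S)"
proof -
  have minus: "- a \<in> H" if "a \<in> H" for a
    using assms(3)[OF assms(2) that] by simp
  have "a + b \<in> H" if "a \<in> H" "b \<in> H" for a b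
    using assms(3)[OF that(1) minus[OF that(2)]] by simp
  then show ?thesis
    using assms minus by (intro group.subgroupI) (auto simp: subset_iff)
qed

lemma path_cycles_bdry_0:
  "path_cycles bdry G 0 = {c. Poly_Mapping.keys c \<subseteq> vertex_seqs G 0 \<and> bdry c = 0}"
  by (auto simp: path_cycles_def path_chains_bdry_le1 allowed_chains_def allowed_seqs_nonpos)

lemma path_boundaries_bdry_0: "path_boundaries bdry G 0 = bdry ` allowed_chains G 1"
  by (simp add: path_boundaries_def path_chains_bdry_le1)

lemma path_boundaries_subset_path_cycles_0: "path_boundaries bdry G 0 \<subseteq> path_cycles bdry G 0"
  using keys_bdry[of _ G 1]
  by (auto simp: path_cycles_bdry_0 path_boundaries_bdry_0 bdry_bdry_1)
     (auto simp: allowed_chains_def allowed_seqs_def)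

lemma keys_diff_subset:
  "Poly_Mapping.keys a \<subseteq> S \<Longrightarrow> Poly_Mapping.keys b \<subseteq> S \<Longrightarrow> Poly_Mapping.keys (a - b) \<subseteq> S"
  using keys_diff[of a b] by blast

lemma subgroup_path_cycles_0: "subgroup (path_cycles bdry G 0) (seq_group G 0)"
  unfolding seq_group_def
  by (rule subgroup_free_Abelian_groupI)
     (auto simp: path_cycles_bdry_0 bdry_diff dest!: subsetD[OF keys_diff])

lemma zero_in_path_boundaries_0: "0 \<in> path_boundaries bdry G 0"
  unfolding path_boundaries_bdry_0 by (rule image_eqI[of _ _ 0]) (auto simp: allowed_chains_def)

lemma path_boundaries_0_diff:
  assumes "a \<in> path_boundaries bdry G 0" "b \<in> path_boundaries bdry G 0"
  shows "a - b \<in> path_boundaries bdry G 0"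
proof -
  obtain a' b' where "a = bdry a'" "b = bdry b'" "a' \<in> allowed_chains G 1" "b' \<in> allowed_chains G 1"
    using assms by (auto simp: path_boundaries_bdry_0)
  then show ?thesis
    unfolding path_boundaries_bdry_0
    by (intro image_eqI[of _ _ "a' - b'"])
       (auto simp: bdry_diff allowed_chains_def dest!: subsetD[OF keys_diff])
qed

lemma subgroup_path_boundaries_0:
  "subgroup (path_boundaries bdry G 0) (subgroup_generated (seq_group G 0) (path_cycles bdry G 0))"
proof (rule group.subgroup_of_subgroup_generated)
  show "subgroup (path_boundaries bdry G 0) (seq_group G 0)"
    using path_boundaries_subset_path_cycles_0[of G] subgroup.subset[OF subgroup_path_cycles_0[of G]]
    unfolding seq_group_def
    by (intro subgroup_free_Abelian_groupI)
       (auto simp: zero_in_path_boundaries_0 path_boundaries_0_diff)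
qed (simp_all add: seq_group_def path_boundaries_subset_path_cycles_0)

lemma comm_group_path_cycles_0:
  "comm_group (subgroup_generated (seq_group G 0) (path_cycles bdry G 0))"
  unfolding seq_group_def
  by (simp add: abelian_free_Abelian_group group.abelian_subgroup_generated)

lemma carrier_path_cycles_0:
  "carrier (subgroup_generated (seq_group G 0) (path_cycles bdry G 0)) = path_cycles bdry G 0"
  by (rule subgroup.carrier_subgroup_generated_subgroup[OF subgroup_path_cycles_0])

section \<open>Cuts, taken in both orientations, and vanishing of the zeroth Betti number\<close>

definition cut :: "'a set \<Rightarrow> 'a set \<Rightarrow> ('a \<times> 'a) set" where
  "cut V S = S \<times> (V - S) \<union> (V - S) \<times> S"

text \<open>The difference of a vertex in \<open>S\<close> and one outside is a cycle. The total
  coefficient on \<open>S\<close> vanishes on boundaries but equals \<open>k\<close> on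
  \<open>k\<close> times this cycle, which therefore has infinite order in homology.\<close>

lemma betti_0_pos:
  assumes "S \<subseteq> pverts G" "S \<noteq> {}" "S \<noteq> pverts G" and cut: "parcs G \<inter> cut (pverts G) S = {}"
  shows "betti 0 G > 0"
proof -
  let ?C = "subgroup_generated (seq_group G 0) (path_cycles bdry G 0)"
  obtain u v where u: "u \<in> S" "u \<in> pverts G" and v: "v \<in> pverts G" "v \<notin> S"
    using assms by blast
  define x where "x = frag_of [u] - frag_of [v]"
  \<comment> \<open>On degree-zero chains this is the total coefficient on \<open>S\<close>. It
    takes values in the multiples of \<open>frag_of []\<close>, so that \<open>frag_extend\<close>
    can define it.\<close>
  define weight :: "('a list \<Rightarrow>\<^sub>0 int) \<Rightarrow> ('a list \<Rightarrow>\<^sub>0 int)"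
    where "weight = frag_extend (\<lambda>xs. if set xs \<subseteq> S then frag_of [] else 0)"
  have weight_bdry: "weight (bdry c) = 0" if "Poly_Mapping.keys c \<subseteq> allowed_seqs G 1" for c
    using that
  proof (induction c rule: frag_induction)
    case (one xs)
    then obtain a b where "xs = [a, b]" "a \<in> pverts G" "b \<in> pverts G" "(a, b) \<in> parcs G"
      by (auto simp: allowed_seqs_1)
    \<comment> \<open>An arc with endpoints on different sides would lie in the cut; on the same
      side the two weights cancel.\<close>
    moreover from this cut have "a \<in> S \<longleftrightarrow> b \<in> S"
      by (auto simp: cut_def)
    ultimately show ?case
      by (auto simp: bdry_arc weight_def frag_extend_diff)
  qed (auto simp: bdry_diff weight_def frag_extend_diff)
  have keys_x: "Poly_Mapping.keys x \<subseteq> vertex_seqs G 0"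
    unfolding x_def using u v by (intro keys_diff_subset) (auto simp: vertex_seqs_0)
  have x: "x \<in> path_cycles bdry G 0"
    using keys_x by (auto simp: path_cycles_bdry_0 x_def bdry_diff bdry_vertex)
  have "abelian_rank (?C Mod path_boundaries bdry G 0) > 0"
  proof (rule comm_group.abelian_rank_Mod_pos[OF comm_group_path_cycles_0 subgroup_path_boundaries_0])
    show "x \<in> carrier ?C"
      using x by (simp add: carrier_path_cycles_0)
    fix k :: int
    assume "x [^]\<^bsub>?C\<^esub> k \<in> path_boundaries bdry G 0"
    also have "x [^]\<^bsub>?C\<^esub> k = x [^]\<^bsub>seq_group G 0\<^esub> k"
      using x by (intro group.int_pow_subgroup_generated)
        (simp_all add: carrier_path_cycles_0, simp add: seq_group_def)
    also have "\<dots> = frag_cmul k x"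
      using keys_x by (simp add: seq_group_def)
    finally have "weight (frag_cmul k x) = 0"
      using weight_bdry by (auto simp: path_boundaries_bdry_0 allowed_chains_def)
    also have "weight (frag_cmul k x) = frag_cmul k (frag_of [])"
      using u v by (simp add: weight_def x_def frag_extend_cmul frag_extend_diff)
    finally show "k = 0"
      by simp
  qed
  then show ?thesis
    by (simp add: betti_def path_homology_group_def)
qed

text \<open>Fix a root \<open>r\<close>. The vertices homologous to \<open>r\<close> have no arc to
  or from the rest, so they exhaust the graph. Every degree-zero chain is then homologous to a
  multiple of the root, and for a cycle that multiple is zero.\<close>

lemma betti_0_eq_0:
  assumes "pverts G \<noteq> {}"
    and cut: "\<And>S. S \<subseteq> pverts G \<Longrightarrow> S \<noteq> {} \<Longrightarrow> S \<noteq> pverts G \<Longrightarrow> parcs G \<inter> cut (pverts G) S \<noteq> {}"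
  shows "betti 0 G = 0"
proof -
  let ?B = "path_boundaries bdry G 0"
  obtain r where r: "r \<in> pverts G"
    using assms(1) by blast
  have arc: "frag_of [v] - frag_of [u] \<in> ?B"
    if "u \<in> pverts G" "v \<in> pverts G" "(u, v) \<in> parcs G" for u v
    unfolding path_boundaries_bdry_0 using that
    by (intro image_eqI[of _ _ "frag_of [u, v]"]) (auto simp: bdry_arc allowed_chains_def allowed_seqs_1)
  define T where "T = {v \<in> pverts G. frag_of [v] - frag_of [r] \<in> ?B}"
  have "T \<subseteq> pverts G"
    by (auto simp: T_def)
  have "T = pverts G"
  proof (rule ccontr)
    assume "T \<noteq> pverts G"
    moreover have "r \<in> T"
      using r by (simp add: T_def zero_in_path_boundaries_0)
    ultimately obtain a b where ab: "a \<in> T" "b \<in> pverts G" "b \<notin> T" "(a, b) \<in> parcs G \<or> (b, a) \<in> parcs G"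
      using cut[of T] \<open>T \<subseteq> pverts G\<close> by (fastforce simp: cut_def)
    then have a: "a \<in> pverts G" "frag_of [a] - frag_of [r] \<in> ?B"
      by (auto simp: T_def)
    have "frag_of [a] - frag_of [b] \<in> ?B"
      using ab(4)
    proof
      assume "(a, b) \<in> parcs G"
      then show ?thesis
        \<comment> \<open>The arc yields the opposite sign; subtracting from 0 reverses it.\<close>
        using path_boundaries_0_diff[OF zero_in_path_boundaries_0 arc[of a b]] a(1) ab(2) by simp
    qed (use arc a(1) ab(2) in auto)
    from path_boundaries_0_diff[OF a(2) this] show False
      using ab(2,3) by (simp add: T_def)
  qed
  \<comment> \<open>The witness \<open>k\<close> is the coefficient sum of \<open>c\<close>: 0 for
    the zero chain, 1 for a generator, and additive under differences.\<close>
  have normal_form: "\<exists>k. bdry c = frag_cmul k (frag_of []) \<and> c - frag_cmul k (frag_of [r]) \<in> ?B"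
    if "Poly_Mapping.keys c \<subseteq> vertex_seqs G 0" for c
    using that
  proof (induction c rule: frag_induction)
    case zero
    show ?case
      by (intro exI[of _ 0]) (simp add: zero_in_path_boundaries_0)
  next
    case (one xs)
    then obtain v where "xs = [v]" "v \<in> T"
      using \<open>T = pverts G\<close> by (auto simp: vertex_seqs_0)
    then show ?case
      by (intro exI[of _ 1]) (auto simp: bdry_vertex T_def)
  next
    case (diff a b)
    then obtain k l where
      "bdry a = frag_cmul k (frag_of [])" "a - frag_cmul k (frag_of [r]) \<in> ?B"
      "bdry b = frag_cmul l (frag_of [])" "b - frag_cmul l (frag_of [r]) \<in> ?B"
      by blast
    then show ?case
      using path_boundaries_0_diff[of "a - frag_cmul k (frag_of [r])" G "b - frag_cmul l (frag_of [r])"]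
      by (intro exI[of _ "k - l"]) (simp add: bdry_diff frag_cmul_diff_distrib
          diff_diff_eq add_diff_eq diff_add_eq diff_diff_eq2 add.commute)
  qed
  have "c \<in> ?B" if c: "c \<in> path_cycles bdry G 0" for c
  proof -
    obtain k where "bdry c = frag_cmul k (frag_of [])" "c - frag_cmul k (frag_of [r]) \<in> ?B"
      using normal_form[of c] c by (auto simp: path_cycles_bdry_0)
    moreover from c this(1) have "k = 0"
      by (simp add: path_cycles_bdry_0)
    ultimately show ?thesis
      by simp
  qed
  then have "?B = carrier (subgroup_generated (seq_group G 0) (path_cycles bdry G 0))"
    using path_boundaries_subset_path_cycles_0[of G] by (auto simp: carrier_path_cycles_0)
  then show ?thesis
    using comm_group.abelian_rank_Mod_self[OF comm_group_path_cycles_0[of G]]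
    by (simp add: betti_def path_homology_group_def)
qed

section \<open>Cuts in random digraphs\<close>

text \<open>By independence the probability is a product over slots, in which a slot outside
  \<open>F\<close> contributes 1.\<close>

lemma prob_no_arcs:
  assumes "F \<subseteq> arc_slots n" "p \<in> {0..1}"
  shows "measure_pmf.prob (random_digraph n p) {G. parcs G \<inter> F = {}} = (1 - p) ^ card F"
proof -
  let ?P = "Pi_pmf (arc_slots n) False (\<lambda>_. bernoulli_pmf p)"
  have "measure_pmf.prob (random_digraph n p) {G. parcs G \<inter> F = {}}
      = measure_pmf.prob ?P (Pi (arc_slots n) (\<lambda>e. if e \<in> F then {False} else UNIV))"
    using assms(1) unfolding random_digraph_def measure_map_pmf
    by (intro arg_cong[where f = "measure_pmf.prob ?P"]) (fastforce simp: Pi_iff)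
  also have "\<dots> = (\<Prod>e\<in>arc_slots n. if e \<in> F then 1 - p else 1)"
    using assms(2) finite_arc_slots
    by (subst measure_Pi_pmf_Pi) (auto intro!: prod.cong simp: measure_pmf_single)
  also have "\<dots> = (\<Prod>e\<in>F. 1 - p)"
    using assms(1) finite_arc_slots by (simp add: prod.If_cases Int_absorb1)
  finally show ?thesis
    by simp
qed

lemma cut_subset_arc_slots: "S \<subseteq> {1..n} \<Longrightarrow> cut {1..n} S \<subseteq> arc_slots n"
  by (auto simp: cut_def arc_slots_def)

lemma cut_Diff: "S \<subseteq> V \<Longrightarrow> cut V (V - S) = cut V S"
  by (auto simp: cut_def)

lemma finite_cut: "finite V \<Longrightarrow> S \<subseteq> V \<Longrightarrow> finite (cut V S)"
  by (auto simp: cut_def dest: finite_subset)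

lemma card_cut:
  assumes "finite V" "S \<subseteq> V"
  shows "card (cut V S) = 2 * (card S * (card V - card S))"
proof -
  have "finite S"
    using assms finite_subset by blast
  then have "card (cut V S) = card (S \<times> (V - S)) + card ((V - S) \<times> S)"
    unfolding cut_def using assms by (intro card_Un_disjoint) auto
  then show ?thesis
    using assms \<open>finite S\<close> by (simp add: card_cartesian_product card_Diff_subset)
qed

lemma prob_cut_empty:
  assumes "S \<subseteq> {1..n}" "p \<in> {0..1}"
  shows "measure_pmf.prob (random_digraph n p) {G. parcs G \<inter> cut {1..n} S = {}}
    = ((1 - p)\<^sup>2) ^ (card S * (n - card S))"
  using assms prob_no_arcs[OF cut_subset_arc_slots[OF assms(1)] assms(2)]
  by (simp add: card_cut power_mult)

text \<open>The two cuts share exactly the two arcs between \<open>u\<close> and \<open>v\<close>,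
  so their union has \<open>4 * (n - 1) - 2 = 2 * (2 * n - 3)\<close> slots.\<close>

lemma prob_two_isolated:
  assumes "u \<in> {1..n}" "v \<in> {1..n}" "u \<noteq> v" "p \<in> {0..1}"
  shows "measure_pmf.prob (random_digraph n p)
      {G. parcs G \<inter> cut {1..n} {u} = {} \<and> parcs G \<inter> cut {1..n} {v} = {}}
    = ((1 - p)\<^sup>2) ^ (2 * n - 3)"
proof -
  have fin: "finite (cut {1..n} {u})" "finite (cut {1..n} {v})"
    using assms by (auto intro!: finite_cut)
  have "cut {1..n} {u} \<inter> cut {1..n} {v} = {(u, v), (v, u)}"
    using assms by (auto simp: cut_def)
  then have "card (cut {1..n} {u} \<union> cut {1..n} {v}) + 2 = 2 * (n - 1) + 2 * (n - 1)"
    using card_Un_Int[OF fin] assms by (simp add: card_cut)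
  then have card: "card (cut {1..n} {u} \<union> cut {1..n} {v}) = 2 * (2 * n - 3)"
    by linarith
  have "{G :: nat pair_pre_digraph. parcs G \<inter> cut {1..n} {u} = {} \<and> parcs G \<inter> cut {1..n} {v} = {}}
      = {G. parcs G \<inter> (cut {1..n} {u} \<union> cut {1..n} {v}) = {}}"
    by blast
  then show ?thesis
    using assms prob_no_arcs[of "cut {1..n} {u} \<union> cut {1..n} {v}" n p]
      cut_subset_arc_slots[of "{u}" n] cut_subset_arc_slots[of "{v}" n] card
    by (simp add: power_mult)
qed

text \<open>A union bound over empty cuts. A set and its complement have the same cut, so sizes up
  to \<open>n div 2\<close> suffice.\<close>

lemma prob_betti_0_pos_le:
  assumes "n \<ge> 1" "p \<in> {0..1}"
  shows "measure_pmf.prob (random_digraph n p) {G. betti 0 G \<noteq> 0}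
    \<le> (\<Sum>k = 1..n div 2. real (n choose k) * ((1 - p)\<^sup>2) ^ (k * (n - k)))"
proof -
  let ?P = "measure_pmf.prob (random_digraph n p)"
  let ?q = "(1 - p)\<^sup>2"
  define I where "I = {S. S \<subseteq> {1..n} \<and> card S \<in> {1..n div 2}}"
  have fin: "finite I"
    by (rule finite_subset[of _ "Pow {1..n}"]) (auto simp: I_def)
  \<comment> \<open>The restriction to the support provides the vertex set
    \<open>{1..n}\<close>.\<close>
  have "{G. betti 0 G \<noteq> 0} \<inter> set_pmf (random_digraph n p)
      \<subseteq> (\<Union>S\<in>I. {G. parcs G \<inter> cut {1..n} S = {}})"
  proof
    fix G assume G: "G \<in> {G. betti 0 G \<noteq> 0} \<inter> set_pmf (random_digraph n p)"
    then have V: "pverts G = {1..n}"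
      by (auto dest: random_digraph_simple(2))
    then obtain S where S: "S \<subseteq> {1..n}" "S \<noteq> {}" "S \<noteq> {1..n}" "parcs G \<inter> cut {1..n} S = {}"
      using betti_0_eq_0[of G] G assms(1) by auto
    have "finite S"
      using S(1) finite_subset by blast
    then have "0 < card S" "card S < n"
      using S psubset_card_mono[of "{1..n}" S] by (auto simp: card_gt_0_iff)
    moreover have "card ({1..n} - S) = n - card S"
      using S(1) \<open>finite S\<close> by (simp add: card_Diff_subset)
    ultimately have "S \<in> I \<or> {1..n} - S \<in> I"
      using S(1) by (auto simp: I_def)
    then show "G \<in> (\<Union>S\<in>I. {G. parcs G \<inter> cut {1..n} S = {}})"
      using S(1,4) cut_Diff[OF S(1)] by auto
  qed
  then have "?P {G. betti 0 G \<noteq> 0} \<le> ?P (\<Union>S\<in>I. {G. parcs G \<inter> cut {1..n} S = {}})"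
    by (subst measure_Int_set_pmf[symmetric]) (intro measure_pmf.finite_measure_mono, auto)
  also have "\<dots> \<le> (\<Sum>S\<in>I. ?P {G. parcs G \<inter> cut {1..n} S = {}})"
    using fin by (intro measure_pmf.finite_measure_subadditive_finite) auto
  also have "\<dots> = (\<Sum>S\<in>I. ?q ^ (card S * (n - card S)))"
    using assms(2) by (intro sum.cong prob_cut_empty) (auto simp: I_def)
  also have "\<dots> = (\<Sum>k = 1..n div 2. \<Sum>S\<in>{S \<in> I. card S = k}. ?q ^ (card S * (n - card S)))"
    using fin by (intro sum.group[symmetric]) (auto simp: I_def)
  also have "\<dots> = (\<Sum>k = 1..n div 2. real (n choose k) * ?q ^ (k * (n - k)))"
  proof (intro sum.cong refl)
    fix k assume k: "k \<in> {1..n div 2}"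
    then have "{S \<in> I. card S = k} = {S. S \<subseteq> {1..n} \<and> card S = k}"
      by (auto simp: I_def)
    then show "(\<Sum>S\<in>{S \<in> I. card S = k}. ?q ^ (card S * (n - card S)))
        = real (n choose k) * ?q ^ (k * (n - k))"
      using n_subsets[of "{1..n}" k] by simp
  qed
  finally show ?thesis .
qed

section \<open>The supercritical regime\<close>

text \<open>One term of the exponential series is at most the whole sum.\<close>

lemma power_le_exp_fact: "real k ^ k \<le> exp (real k) * fact k"
proof -
  have "real k ^ k / fact k \<le> exp (real k)"
    unfolding exp_def using sum_le_suminf[OF summable_exp_generic[of "real k"], of "{k}"]
    by (simp add: divide_inverse mult.commute)
  then show ?thesis
    by (simp add: divide_le_eq)
qed

text \<open>This is the bound \<open>(e * n / k) ^ k\<close> in exponential form, from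
  \<open>(n choose k) * fact k\<close> \<le> \<open>n ^ k\<close>.\<close>

lemma binomial_le_exp:
  assumes "1 \<le> k" "k \<le> n"
  shows "real (n choose k) \<le> exp (real k * (ln (real n) - ln (real k) + 1))"
proof -
  have "real (n choose k) * real k ^ k \<le> real (n choose k) * (exp (real k) * fact k)"
    by (intro mult_left_mono power_le_exp_fact) simp
  also have "\<dots> \<le> exp (real k) * real n ^ k"
    using of_nat_mono[OF binomial_fact_pow[of n k], where 'a = real]
    by (simp add: mult.left_commute)
  finally have "real (n choose k) \<le> exp (real k) * real n ^ k / real k ^ k"
    using assms by (simp add: le_divide_eq)
  also have "\<dots> = exp (real k * (ln (real n) - ln (real k) + 1))"
    using assms by (simp add: distrib_left right_diff_distrib exp_add exp_diff exp_of_nat_mult)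
  finally show ?thesis .
qed

text \<open>With \<open>t = k / n\<close>, the binomial bound and \<open>q\<close> \<le>
  \<open>exp (- (1 - q))\<close> give \<open>k\<close> times
  \<open>1 - ln k + t * ln n - (1 - t) * f\<close> in the exponent. It remains to use
  \<open>t * ln n\<close> \<le> \<open>ln k + 1\<close> and \<open>t\<close> \<le>
  \<open>1 / 2\<close>.\<close>

lemma binomial_cut_bound:
  fixes q f :: real
  assumes k: "1 \<le> k" "2 * k \<le> n" and f: "0 \<le> f"
    and q: "0 \<le> q" "1 - q = (ln (real n) + f) / real n"
  shows "real (n choose k) * q ^ (k * (n - k)) \<le> exp (2 - f / 2) ^ k"
proof -
  define t where "t = real k / real n"
  have n: "n > 0" and t: "0 < t" "t \<le> 1 / 2"
    using k by (auto simp: t_def field_simps)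
  \<comment> \<open>Comparing with \<open>2 * k\<close> instead of \<open>k\<close> lets
    \<open>t\<close> \<le> \<open>1 / 2\<close> halve the logarithm of \<open>2 * k\<close> below,
    while multiplying the right-hand side by \<open>t\<close> gives
    \<open>1 / 2 - t\<close>.\<close>
  have "ln (real n) - ln (2 * real k) \<le> real n / (2 * real k) - 1"
    using ln_le_minus_one[of "real n / (2 * real k)"] k n by (simp add: ln_div)
  then have "t * (ln (real n) - ln (2 * real k)) \<le> t * (real n / (2 * real k) - 1)"
    using t by (intro mult_left_mono) auto
  also have "\<dots> \<le> 1 / 2"
    using t k n by (simp add: t_def field_simps)
  also have "t * (ln (real n) - ln (2 * real k)) = t * ln (real n) - t * ln (2 * real k)"
    by (simp add: algebra_simps)
  finally have "t * ln (real n) \<le> t * ln (2 * real k) + 1 / 2"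
    by simp
  also have "t * ln (2 * real k) \<le> 1 / 2 * ln (2 * real k)"
    using t k by (intro mult_right_mono) auto
  also have "ln (2 * real k) \<le> 1 + ln (real k)"
    using k ln_le_minus_one[of 2] by (simp add: ln_mult)
  also have "1 / 2 * (1 + ln (real k)) + 1 / 2 \<le> ln (real k) + 1"
    using k by (simp add: field_simps)
  finally have tn: "t * ln (real n) \<le> ln (real k) + 1"
    by simp
  have "q = 1 - (ln (real n) + f) / real n"
    using q(2) by simp
  also have "\<dots> \<le> exp (- ((ln (real n) + f) / real n))"
    using exp_ge_add_one_self[of "- ((ln (real n) + f) / real n)"] by simp
  finally have "q ^ (k * (n - k)) \<le> exp (- ((ln (real n) + f) / real n)) ^ (k * (n - k))"
    using q(1) by (intro power_mono) auto
  also have "\<dots> = exp (- (real k * ((1 - t) * (ln (real n) + f))))"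
    using k n by (simp add: t_def of_nat_diff field_simps flip: exp_of_nat_mult)
  finally have "real (n choose k) * q ^ (k * (n - k))
      \<le> exp (real k * (ln (real n) - ln (real k) + 1)) * exp (- (real k * ((1 - t) * (ln (real n) + f))))"
    using k q(1) by (intro mult_mono binomial_le_exp) auto
  also have "\<dots> = exp (real k * (1 - ln (real k) + t * ln (real n) - (1 - t) * f))"
    by (simp add: algebra_simps flip: exp_add)
  also have "\<dots> \<le> exp (real k * (2 - f / 2))"
  proof -
    have "1 / 2 * f \<le> (1 - t) * f"
      using t f by (intro mult_right_mono) auto
    then show ?thesis
      using tn by (simp add: mult_left_mono)
  qed
  finally show ?thesis
    by (simp add: exp_of_nat_mult)
qed

text \<open>The condition \<open>f > 4\<close> makes the ratio \<open>r\<close> less than 1, so the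
  sum over cut sizes is bounded by the full geometric series.\<close>

lemma prob_betti_0_pos_le_geometric:
  assumes "n \<ge> 1" "p \<in> {0..1}" and f: "1 - (1 - p)\<^sup>2 = (ln (real n) + f) / real n" "f > 4"
  defines "r \<equiv> exp (2 - f / 2)"
  shows "measure_pmf.prob (random_digraph n p) {G. betti 0 G \<noteq> 0} \<le> r / (1 - r)"
proof -
  have r: "0 < r" "r < 1"
    using f by (auto simp: r_def)
  have "measure_pmf.prob (random_digraph n p) {G. betti 0 G \<noteq> 0}
      \<le> (\<Sum>k = 1..n div 2. real (n choose k) * ((1 - p)\<^sup>2) ^ (k * (n - k)))"
    using assms by (intro prob_betti_0_pos_le)
  also have "\<dots> \<le> (\<Sum>k = 1..n div 2. r ^ k)"
    unfolding r_def using f by (intro sum_mono binomial_cut_bound) auto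
  also have "\<dots> = r * (\<Sum>k < n div 2. r ^ k)"
    by (simp add: sum_distrib_left sum.atLeast1_atMost_eq)
  also have "\<dots> \<le> r * (1 / (1 - r))"
    using r geometric_sum_less[of r "{..<n div 2}"] by (intro mult_left_mono) auto
  finally show ?thesis
    by simp
qed

section \<open>The subcritical regime\<close>

text \<open>Chebyshev's inequality for the number \<open>X\<close> of isolated vertices, with mean
  \<mu>: a vanishing zeroth Betti number forces \<open>X = 0\<close>. The term
  \<open>1 / q - 1\<close> is the price of the dependence between two vertices.\<close>

lemma prob_betti_0_eq_0_le:
  assumes "n \<ge> 2" "p \<in> {0..<1}"
  defines "q \<equiv> (1 - p)\<^sup>2"
  shows "measure_pmf.prob (random_digraph n p) {G. betti 0 G = 0}
    \<le> 1 / (real n * q ^ (n - 1)) + 1 / q - 1"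
proof -
  let ?M = "measure_pmf (random_digraph n p)"
  define isolated where "isolated v = {G :: nat pair_pre_digraph. parcs G \<inter> cut {1..n} {v} = {}}" for v
  define X :: "nat pair_pre_digraph \<Rightarrow> real" where "X G = (\<Sum>v = 1..n. indicator (isolated v) G)" for G
  have integrable_indicator: "integrable ?M (indicator A :: nat pair_pre_digraph \<Rightarrow> real)" for A
    by (rule integrable_real_indicator) (simp_all add: measure_pmf.emeasure_eq_measure)
  define \<mu> where "\<mu> = real n * q ^ (n - 1)"
  have p: "p \<in> {0..1}" and q: "0 < q"
    using assms by (auto simp: q_def)
  have \<mu>: "\<mu> > 0"
    using q assms(1) by (simp add: \<mu>_def)
  have single: "measure ?M (isolated v) = q ^ (n - 1)" if "v \<in> {1..n}" for v
    using prob_cut_empty[of "{v}" n p] that p by (simp add: isolated_def q_def)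
  have pair: "measure ?M (isolated u \<inter> isolated v) = q ^ (2 * n - 3)"
    if "u \<in> {1..n}" "v \<in> {1..n}" "u \<noteq> v" for u v
    using prob_two_isolated[OF that p] by (simp add: isolated_def q_def Int_def)
  have "measure_pmf.expectation (random_digraph n p) X = (\<Sum>v = 1..n. measure ?M (isolated v))"
    unfolding X_def
    by (subst Bochner_Integration.integral_sum) (simp_all add: integrable_indicator)
  also have "\<dots> = \<mu>"
    using single by (simp add: \<mu>_def)
  finally have mean: "measure_pmf.expectation (random_digraph n p) X = \<mu>" .
  have square: "(X G)\<^sup>2 = (\<Sum>u = 1..n. \<Sum>v = 1..n. indicator (isolated u \<inter> isolated v) G)" for G
    by (simp add: X_def power2_eq_square sum_product indicator_inter_arith)
  have integrable_X: "integrable ?M X"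
    unfolding X_def by (simp add: integrable_indicator)
  have int: "integrable ?M (\<lambda>G. (X G)\<^sup>2)"
    unfolding square by (simp add: integrable_indicator)
  have "measure_pmf.expectation (random_digraph n p) (\<lambda>G. (X G)\<^sup>2)
      = (\<Sum>u = 1..n. \<Sum>v = 1..n. measure ?M (isolated u \<inter> isolated v))"
    unfolding square by (simp add: integrable_indicator)
  \<comment> \<open>Each row splits into its diagonal entry, a single isolation probability, and
    \<open>n - 1\<close> equal pair probabilities.\<close>
  also have "\<dots> = (\<Sum>u = 1..n. q ^ (n - 1) + (real n - 1) * q ^ (2 * n - 3))"
  proof (intro sum.cong refl)
    fix u assume u: "u \<in> {1..n}"
    have "(\<Sum>v = 1..n. measure ?M (isolated u \<inter> isolated v))
        = measure ?M (isolated u \<inter> isolated u) + (\<Sum>v\<in>{1..n} - {u}. measure ?M (isolated u \<inter> isolated v))"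
      using u by (intro sum.remove) auto
    also have "\<dots> = q ^ (n - 1) + (\<Sum>v\<in>{1..n} - {u}. q ^ (2 * n - 3))"
      using u single pair by simp
    also have "\<dots> = q ^ (n - 1) + (real n - 1) * q ^ (2 * n - 3)"
      using u assms(1) by (simp add: of_nat_diff)
    finally show "(\<Sum>v = 1..n. measure ?M (isolated u \<inter> isolated v))
        = q ^ (n - 1) + (real n - 1) * q ^ (2 * n - 3)" .
  qed
  also have "\<dots> = \<mu> + real n * (real n - 1) * q ^ (2 * n - 3)"
    by (simp add: \<mu>_def algebra_simps)
  finally have second: "measure_pmf.expectation (random_digraph n p) (\<lambda>G. (X G)\<^sup>2)
      = \<mu> + real n * (real n - 1) * q ^ (2 * n - 3)" .
  \<comment> \<open>A pair probability is the square of a single one divided by \<open>q\<close>,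
    because the two isolation events share one undirected pair.\<close>
  have "Suc (2 * n - 3) = (n - 1) * 2"
    using assms(1) by linarith
  then have "q * q ^ (2 * n - 3) = (q ^ (n - 1))\<^sup>2"
    by (simp only: power_mult[symmetric] power_Suc[symmetric])
  then have "q * (real n * (real n - 1) * q ^ (2 * n - 3)) = real n * (real n - 1) * (q ^ (n - 1))\<^sup>2"
    by (metis mult.left_commute)
  also have "\<dots> \<le> real n * real n * (q ^ (n - 1))\<^sup>2"
    by (intro mult_right_mono mult_left_mono) auto
  also have "\<dots> = \<mu>\<^sup>2"
    by (simp add: \<mu>_def power2_eq_square)
  finally have pairs: "real n * (real n - 1) * q ^ (2 * n - 3) \<le> \<mu>\<^sup>2 / q"
    using q by (simp add: field_simps)
  \<comment> \<open>\<open>X = 0\<close> is a deviation of exactly \<mu> from the mean.\<close>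
  have "{G. betti 0 G = 0} \<inter> set_pmf (random_digraph n p) \<subseteq> {G \<in> space ?M. \<mu> \<le> \<bar>X G - \<mu>\<bar>}"
  proof
    fix G assume G: "G \<in> {G. betti 0 G = 0} \<inter> set_pmf (random_digraph n p)"
    then have V: "pverts G = {1..n}"
      by (auto dest: random_digraph_simple(2))
    have "G \<notin> isolated v" if v: "v \<in> {1..n}" for v
    proof
      assume "G \<in> isolated v"
      \<comment> \<open>\<open>n\<close> \<ge> 2 makes the singleton a proper subset, as
        \<open>betti_0_pos\<close> demands.\<close>
      moreover have "{v} \<noteq> {1..n}"
        using assms(1) by (auto dest!: arg_cong[where f = card])
      ultimately show False
        using betti_0_pos[of "{v}" G] v V G by (simp add: isolated_def)
    qed
    then have "X G = 0"
      by (simp add: X_def)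
    then show "G \<in> {G \<in> space ?M. \<mu> \<le> \<bar>X G - \<mu>\<bar>}"
      using \<mu> by simp
  qed
  then have "measure ?M {G. betti 0 G = 0} \<le> measure ?M {G \<in> space ?M. \<mu> \<le> \<bar>X G - \<mu>\<bar>}"
    by (subst measure_Int_set_pmf[symmetric]) (intro measure_pmf.finite_measure_mono, auto)
  also have "\<dots> \<le> measure_pmf.variance (random_digraph n p) X / \<mu>\<^sup>2"
    using measure_pmf.Chebyshev_inequality[of X "random_digraph n p" \<mu>] int \<mu> mean by simp
  also have "measure_pmf.variance (random_digraph n p) X = \<mu> + real n * (real n - 1) * q ^ (2 * n - 3) - \<mu>\<^sup>2"
    using measure_pmf.variance_eq[OF integrable_X int] by (simp only: mean second)
  also have "\<dots> \<le> \<mu> + \<mu>\<^sup>2 / q - \<mu>\<^sup>2"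
    using pairs by simp
  also have "(\<mu> + \<mu>\<^sup>2 / q - \<mu>\<^sup>2) / \<mu>\<^sup>2 = 1 / \<mu> + 1 / q - 1"
    using \<mu> q by (simp add: field_simps power2_eq_square)
  finally show ?thesis
    using \<mu> by (simp add: divide_right_mono \<mu>_def)
qed

text \<open>With \<open>x = 1 - q\<close> \<le> \<open>1 / 2\<close>, the bound
  \<open>ln (1 - x)\<close> \<ge> \<open>- x - 2 * x^2\<close> gives \<open>ln (n * q ^ n)\<close>
  \<ge> \<open>- f - 2 * n * x^2\<close>, since \<open>n * x = ln n + f\<close>.\<close>

lemma inverse_expected_isolated_le:
  fixes q f :: real
  assumes "n \<ge> 1" "1 / 2 \<le> q" "q \<le> 1" and q: "1 - q = (ln (real n) + f) / real n" and "f \<le> 0"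
  shows "1 / (real n * q ^ (n - 1)) \<le> exp (f + 2 * (ln (real n))\<^sup>2 / real n)"
proof -
  define x where "x = 1 - q"
  have x: "0 \<le> x" "x \<le> 1 / 2" "q = 1 - x"
    using assms(2,3) by (auto simp: x_def)
  have nx: "real n * x = ln (real n) + f"
    using assms(1) q by (simp add: x_def)
  have "real n * (2 * x\<^sup>2) = 2 * (real n * x)\<^sup>2 / real n"
    using assms(1) by (simp add: power2_eq_square)
  \<comment> \<open>Here \<open>f\<close> \<le> 0 gives 0 \<le> \<open>n * x\<close> \<le>
    \<open>ln n\<close>.\<close>
  also have "(real n * x)\<^sup>2 \<le> (ln (real n))\<^sup>2"
    using nx \<open>f \<le> 0\<close> mult_nonneg_nonneg[of "real n" x] x(1) by (intro power_mono) auto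
  finally have nx2: "real n * (2 * x\<^sup>2) \<le> 2 * (ln (real n))\<^sup>2 / real n"
    by (simp add: divide_right_mono)
  have "exp (- (f + 2 * (ln (real n))\<^sup>2 / real n)) \<le> exp (ln (real n) + real n * (- x - 2 * x\<^sup>2))"
    using nx2 nx by (simp add: algebra_simps)
  also have "\<dots> \<le> exp (ln (real n) + real n * ln (1 - x))"
    using ln_one_minus_pos_lower_bound[OF x(1,2)] by (simp add: mult_left_mono)
  also have "\<dots> = real n * q ^ n"
    using assms(1) x by (simp add: exp_add exp_of_nat_mult)
  also have "\<dots> \<le> real n * q ^ (n - 1)"
    using assms by (intro mult_left_mono power_decreasing) auto
  finally have le: "exp (- (f + 2 * (ln (real n))\<^sup>2 / real n)) \<le> real n * q ^ (n - 1)" .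
  have "1 / (real n * q ^ (n - 1)) \<le> 1 / exp (- (f + 2 * (ln (real n))\<^sup>2 / real n))"
    using le assms(1,2) by (intro divide_left_mono mult_pos_pos zero_less_power) auto
  also have "\<dots> = exp (f + 2 * (ln (real n))\<^sup>2 / real n)"
    by (simp only: exp_minus inverse_eq_divide) simp
  finally show ?thesis .
qed

section \<open>The threshold\<close>

lemma whpI_compl:
  assumes "\<forall>\<^sub>F n in sequentially. measure_pmf.prob (D n) {x. \<not> P x} \<le> b n" "b \<longlonglongrightarrow> 0"
  shows "whp D P"
proof -
  have "(\<lambda>n. measure_pmf.prob (D n) {x. \<not> P x}) \<longlonglongrightarrow> 0"
    using assms(1) by (intro tendsto_sandwich[OF _ _ tendsto_const assms(2)]) auto
  then have "(\<lambda>n. 1 - measure_pmf.prob (D n) {x. \<not> P x}) \<longlonglongrightarrow> 1 - 0"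
    by (intro tendsto_intros)
  moreover have "1 - measure_pmf.prob (D n) {x. \<not> P x} = measure_pmf.prob (D n) {x. P x}" for n
    using measure_pmf.prob_compl[of "{x. \<not> P x}" "D n"] by (simp add: Diff_eq Collect_neg_eq[symmetric])
  ultimately show ?thesis
    by (simp add: whp_def)
qed

text \<open>Eventually \<open>f n > 4\<close>, and the geometric bound tends to 0 because its ratio
  does.\<close>

lemma whp_betti_0_eq_0:
  fixes p f :: "nat \<Rightarrow> real"
  assumes p: "\<And>n. n \<ge> 1 \<Longrightarrow> p n \<in> {0..1}"
    and f: "\<And>n. n \<ge> 1 \<Longrightarrow> 1 - (1 - p n)\<^sup>2 = (ln (real n) + f n) / real n"
    and lim: "filterlim f at_top sequentially"
  shows "whp (\<lambda>n. random_digraph n (p n)) (\<lambda>G. betti 0 G = 0)"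
proof (rule whpI_compl)
  show "\<forall>\<^sub>F n in sequentially. measure_pmf.prob (random_digraph n (p n)) {G. betti 0 G \<noteq> 0}
      \<le> exp (2 - f n / 2) / (1 - exp (2 - f n / 2))"
    using filterlim_at_top_dense[THEN iffD1, OF lim, rule_format, of 4] eventually_ge_at_top[of 1]
    by eventually_elim (use p f in \<open>auto intro!: prob_betti_0_pos_le_geometric\<close>)
  have "((\<lambda>y::real. exp (2 - y / 2) / (1 - exp (2 - y / 2))) \<longlongrightarrow> 0) at_top"
    by real_asymp
  then show "(\<lambda>n. exp (2 - f n / 2) / (1 - exp (2 - f n / 2))) \<longlonglongrightarrow> 0"
    using lim by (rule filterlim_compose)
qed

text \<open>Both parts of the Chebyshev bound vanish: the inverse mean because \<open>f\<close>
  tends to minus infinity, and \<open>1 / q - 1\<close> because \<open>q\<close> tends to 1.\<close>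

lemma whp_betti_0_pos:
  fixes p f :: "nat \<Rightarrow> real"
  assumes p: "\<And>n. n \<ge> 1 \<Longrightarrow> p n \<in> {0..1}"
    and f: "\<And>n. n \<ge> 1 \<Longrightarrow> 1 - (1 - p n)\<^sup>2 = (ln (real n) + f n) / real n"
    and lim: "filterlim f at_bot sequentially"
  shows "whp (\<lambda>n. random_digraph n (p n)) (\<lambda>G. betti 0 G > 0)"
proof (rule whpI_compl)
  let ?q = "\<lambda>n. (1 - p n)\<^sup>2"
  let ?b = "\<lambda>n. exp (f n + 2 * (ln (real n))\<^sup>2 / real n) + 1 / ?q n - 1"
  have f_le: "\<forall>\<^sub>F n in sequentially. f n \<le> 0"
    using lim by (simp add: filterlim_at_bot)
  \<comment> \<open>Once \<open>f n\<close> \<le> 0, the undirected edge probability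
    \<open>1 - q\<close> is at most \<open>ln n / n\<close>.\<close>
  have "(\<lambda>n. 1 - ?q n) \<longlonglongrightarrow> 0"
  proof (rule tendsto_sandwich)
    show "\<forall>\<^sub>F n in sequentially. 0 \<le> 1 - ?q n"
      using eventually_ge_at_top[of 1]
      by eventually_elim (use p in \<open>auto simp: abs_square_le_1\<close>)
    show "\<forall>\<^sub>F n in sequentially. 1 - ?q n \<le> ln (real n) / real n"
      using f_le eventually_ge_at_top[of 1]
      by eventually_elim (simp add: f divide_right_mono)
    show "(\<lambda>n. ln (real n) / real n) \<longlonglongrightarrow> 0"
      by real_asymp
  qed simp
  from tendsto_diff[OF tendsto_const[of 1] this] have q: "?q \<longlonglongrightarrow> 1"
    by simp
  show "\<forall>\<^sub>F n in sequentially. measure_pmf.prob (random_digraph n (p n)) {G. \<not> betti 0 G > 0} \<le> ?b n"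
    \<comment> \<open>Eventually \<open>q > 1 / 2\<close>, which excludes \<open>p n = 1\<close> and
      admits the logarithm bound.\<close>
    using f_le eventually_ge_at_top[of 2] order_tendstoD(1)[OF q, of "1 / 2", simplified]
  proof eventually_elim
    case (elim n)
    have pn: "p n \<in> {0..1}"
      using p elim by simp
    moreover have "p n \<noteq> 1"
      using elim(3) by auto
    ultimately have "measure_pmf.prob (random_digraph n (p n)) {G. betti 0 G = 0}
        \<le> 1 / (real n * ?q n ^ (n - 1)) + 1 / ?q n - 1"
      using elim by (intro prob_betti_0_eq_0_le) auto
    also have "1 / (real n * ?q n ^ (n - 1)) \<le> exp (f n + 2 * (ln (real n))\<^sup>2 / real n)"
      using elim f[of n] pn by (intro inverse_expected_isolated_le) (auto simp: abs_square_le_1)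
    finally show ?case
      by simp
  qed
  \<comment> \<open>The second-order error vanishes, so adding it to \<open>f\<close> keeps the
    limit minus infinity.\<close>
  have "(\<lambda>n. 2 * (ln (real n))\<^sup>2 / real n) \<longlonglongrightarrow> 0"
    by real_asymp
  then have "filterlim (\<lambda>n. 2 * (ln (real n))\<^sup>2 / real n + f n) at_bot sequentially"
    using lim by (simp add: filterlim_tendsto_add_at_bot_iff)
  then have "(\<lambda>n. exp (f n + 2 * (ln (real n))\<^sup>2 / real n)) \<longlonglongrightarrow> 0"
    by (intro filterlim_compose[OF exp_at_bot]) (simp add: add.commute)
  then have "?b \<longlonglongrightarrow> 0 + 1 / 1 - 1"
    using q by (intro tendsto_intros) auto
  then show "?b \<longlonglongrightarrow> 0"
    by simp
qed

theorem theorem1p2: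
  fixes p f :: "nat \<Rightarrow> real"
  assumes "\<And>n. n \<ge> 1 \<Longrightarrow> p n \<in> {0..1}"
    and "\<And>n. n \<ge> 1 \<Longrightarrow> 1 - (1 - p n)\<^sup>2 = (ln (real n) + f n) / real n"
  shows
    "(filterlim f at_bot sequentially \<longrightarrow>
        whp (\<lambda>n. random_digraph n (p n)) (\<lambda>G. betti 0 G > 0)) \<and>
     (filterlim f at_top sequentially \<longrightarrow>
        whp (\<lambda>n. random_digraph n (p n)) (\<lambda>G. betti 0 G = 0)) \<and>
     (filterlim f at_bot sequentially \<longrightarrow>
        whp (\<lambda>n. random_digraph n (p n)) (\<lambda>G. regular_betti 0 G > 0)) \<and>
     (filterlim f at_top sequentially \<longrightarrow>
        whp (\<lambda>n. random_digraph n (p n)) (\<lambda>G. regular_betti 0 G = 0))"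
  using whp_betti_0_pos[OF assms] whp_betti_0_eq_0[OF assms] by (simp add: regular_betti_0)

end
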